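(* Let $(M,\phi_\alpha,\xi_\alpha,\eta_\alpha,g)$, $\alpha\in\{1,2,3\}$, be a $3$-quasi-Sasakian manifold of rank $4l+1$ such that $[\xi_\alpha,\xi_\beta]=0$ for any $\alpha,\beta\in\{1,2,3\}$ and $[\psi_\alpha,\psi_\alpha]=0$ for some $\alpha\in\{1,2,3\}$. Then $M$ is a $3$-cosymplectic manifold.
   Context: All manifolds are smooth and connected. Convention: $2u\wedge v=u\otimes v-v\otimes u$, so for a $1$-form $\eta$, $2d\eta(X,Y)=X(\eta(Y))-Y(\eta(X))-\eta([X,Y])$. For a $(1,1)$-tensor field $T$, $[T,T](X,Y)=T^2[X,Y]+[TX,TY]-T[TX,Y]-T[X,TY]$ is its Nijenhuis tensor. An almost contact structure on an odd-dimensional manifold $M$ is a triple $(\phi,\xi,\eta)$ of a $(1,1)$-tensor field, a vector field (the Reeb vector field) and a $1$-form with $\phi^2=-I+\eta\otimes\xi$ and $\eta(\xi)=1$. It is normal if $[\phi,\phi]+2d\eta\otimes\xi=0$. A Riemannian metric $g$ is compatible if $g(\phi X,\phi Y)=g(X,Y)-\eta(X)\eta(Y)$; the fundamental $2$-form is $\Phi(X,Y)=g(X,\phi Y)$. An almost $3$-contact metric manifold is a $(4n+3)$-dimensional manifold $M$ with three almost contact structures $(\phi_\alpha,\xi_\alpha,\eta_\alpha)$, $\alpha\in\{1,2,3\}$, and a Riemannian metric $g$ compatible with each of them, such that for every even permutation $(\alpha,\beta,\gamma)$ of $\{1,2,3\}$: $\phi_\gamma=\phi_\alpha\phi_\beta-\eta_\beta\otimes\xi_\alpha=-\phi_\beta\phi_\alpha+\eta_\alpha\otimes\xi_\beta$,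 $\xi_\gamma=\phi_\alpha\xi_\beta=-\phi_\beta\xi_\alpha$, $\eta_\gamma=\eta_\alpha\circ\phi_\beta=-\eta_\beta\circ\phi_\alpha$. It is hyper-normal if each of the three almost contact structures is normal. A $3$-quasi-Sasakian manifold is a hyper-normal almost $3$-contact metric manifold such that each fundamental $2$-form $\Phi_\alpha(X,Y)=g(X,\phi_\alpha Y)$ is closed. A $3$-cosymplectic manifold is a hyper-normal almost $3$-contact metric manifold with $d\eta_\alpha=0$ and $d\Phi_\alpha=0$ for each $\alpha$. Rank: a $1$-form $\eta$ has rank $2p+1$ if $\eta\wedge(d\eta)^p\neq0$ and $(d\eta)^{p+1}=0$ on $M$ (at every point). On a $3$-quasi-Sasakian manifold $\eta_1,\eta_2,\eta_3$ have a common rank, called the rank of $M$; when $[\xi_\alpha,\xi_\beta]=0$ for all $\alpha,\beta$ it is of the form $4l+1$. Let $\mathcal{H}=\bigcap_\alpha\ker\eta_\alpha$ and $\mathcal{V}=\langle\xi_1,\xi_2,\xi_3\rangle$. Put $\mathcal{E}^{4m}=\{X\in\Gamma(\mathcal{H}) : i_Xd\eta_\alpha=0\}$ (independent of $\alpha$, of dimension $4m$ with $m=n-l$), let $\mathcal{E}^{4l}$ be the orthogonal complement of $\mathcal{E}^{4m}$ in $\Gamma(\mathcal{H})$, and $\mathcal{E}^{4m+3}=\mathcal{E}^{4m}\oplus\Gamma(\mathcal{V})$. For each $\alpha$, $\psi_\alpha$ is the $(1,1)$-tensor field with $\psi_\alpha=\phi_\alpha$ on $\mathcal{E}^{4l}$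 and $\psi_\alpha=0$ on $\mathcal{E}^{4m+3}$. *)

theory Defs
  imports "HOL-Analysis.Analysis" "HOL-Library.Function_Algebras"
begin

section \<open>Smooth manifolds\<close>

text \<open>The sets \<open>S\<close> are meant to be open.\<close>

primrec Ck_on :: "nat \<Rightarrow> 'e::euclidean_space set \<Rightarrow> ('e \<Rightarrow> 'f::real_normed_vector) \<Rightarrow> bool" where
  "Ck_on 0 S f \<longleftrightarrow> continuous_on S f"
| "Ck_on (Suc k) S f \<longleftrightarrow> (\<forall>x\<in>S. f differentiable (at x)) \<and>
     (\<forall>v. Ck_on k S (\<lambda>x. frechet_derivative f (at x) v))"

definition smooth_on :: "'e::euclidean_space set \<Rightarrow> ('e \<Rightarrow> 'f::real_normed_vector) \<Rightarrow> bool" where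
  "smooth_on S f \<longleftrightarrow> (\<forall>k. Ck_on k S f)"

text \<open>A chart is a pair of a domain and a coordinate map; values of the map outside the domain
  are irrelevant. The manifold is the whole type \<open>'a\<close>, of dimension \<open>DIM('e)\<close>. The atlas is not
  required to be maximal.\<close>

type_synonym ('a, 'e) atlas = "('a set \<times> ('a \<Rightarrow> 'e)) set"

definition smooth_atlas ::
  "('a::{t2_space,second_countable_topology}, 'e::euclidean_space) atlas \<Rightarrow> bool" where
  "smooth_atlas A \<longleftrightarrow>
     (\<Union>(U, \<kappa>)\<in>A. U) = UNIV \<and>
     (\<forall>(U, \<kappa>)\<in>A. open U \<and> open (\<kappa> ` U) \<and> homeomorphism U (\<kappa> ` U) \<kappa> (inv_into U \<kappa>)) \<and>
     (\<forall>(U, \<kappa>)\<in>A. \<forall>(V, \<mu>)\<in>A. smooth_on (\<kappa> ` (U \<inter> V)) (\<mu> \<circ> inv_into U \<kappa>))"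

definition smooth_manifold ::
  "('a::{t2_space,second_countable_topology}, 'e::euclidean_space) atlas \<Rightarrow> bool" where
  "smooth_manifold A \<longleftrightarrow> smooth_atlas A \<and> connected (UNIV :: 'a set)"

definition C_inf :: "('a, 'e::euclidean_space) atlas \<Rightarrow> ('a \<Rightarrow> real) set" where
  "C_inf A = {f. \<forall>(U, \<kappa>)\<in>A. smooth_on (\<kappa> ` U) (f \<circ> inv_into U \<kappa>)}"


section \<open>Tangent vectors, vector fields and tensor fields\<close>

text \<open>A tangent vector at \<open>p\<close> is a derivation at \<open>p\<close> of the algebra of smooth functions. Since HOL
  functions are total, it is extended by \<open>0\<close> to non-smooth functions, so that tangent vectors are
  equal as soon as they agree on smooth functions. Sums, differences and zero of tangent vectors
  and of vector fields are the pointwise ones from \<^theory>\<open>HOL-Library.Function_Algebras\<close>.\<close>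

type_synonym 'a tvec = "('a \<Rightarrow> real) \<Rightarrow> real"
type_synonym 'a vfield = "'a \<Rightarrow> 'a tvec"
type_synonym 'a form1 = "'a \<Rightarrow> 'a tvec \<Rightarrow> real"
type_synonym 'a bilin = "'a \<Rightarrow> 'a tvec \<Rightarrow> 'a tvec \<Rightarrow> real"
type_synonym 'a tensor11 = "'a \<Rightarrow> 'a tvec \<Rightarrow> 'a tvec"

definition tscale :: "real \<Rightarrow> 'a tvec \<Rightarrow> 'a tvec" (infixr "\<odot>" 75) where
  "c \<odot> v = (\<lambda>f. c * v f)"

definition tangent_space :: "('a, 'e::euclidean_space) atlas \<Rightarrow> 'a \<Rightarrow> 'a tvec set" where
  "tangent_space A p = {v.
     (\<forall>f\<in>C_inf A. \<forall>h\<in>C_inf A. v (\<lambda>x. f x + h x) = v f + v h) \<and>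
     (\<forall>c. \<forall>f\<in>C_inf A. v (\<lambda>x. c * f x) = c * v f) \<and>
     (\<forall>f\<in>C_inf A. \<forall>h\<in>C_inf A. v (\<lambda>x. f x * h x) = f p * v h + h p * v f) \<and>
     (\<forall>f. f \<notin> C_inf A \<longrightarrow> v f = 0)}"

definition vector_fields :: "('a, 'e::euclidean_space) atlas \<Rightarrow> 'a vfield set" where
  "vector_fields A = {X. (\<forall>p. X p \<in> tangent_space A p) \<and>
     (\<forall>f\<in>C_inf A. (\<lambda>p. X p f) \<in> C_inf A)}"

definition lie_bracket :: "'a vfield \<Rightarrow> 'a vfield \<Rightarrow> 'a vfield" where
  "lie_bracket X Y = (\<lambda>p f. X p (\<lambda>q. Y q f) - Y p (\<lambda>q. X q f))"

text \<open>Pointwise application of a tensor field or form to vector fields.\<close>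

definition app :: "('a \<Rightarrow> 'a tvec \<Rightarrow> 'c) \<Rightarrow> 'a vfield \<Rightarrow> 'a \<Rightarrow> 'c" where
  "app T X = (\<lambda>p. T p (X p))"

definition app2 :: "'a bilin \<Rightarrow> 'a vfield \<Rightarrow> 'a vfield \<Rightarrow> 'a \<Rightarrow> real" where
  "app2 T X Y = (\<lambda>p. T p (X p) (Y p))"

text \<open>Tensor fields are only constrained on tangent vectors; their values elsewhere are
  irrelevant.\<close>

definition one_form :: "('a, 'e::euclidean_space) atlas \<Rightarrow> 'a form1 \<Rightarrow> bool" where
  "one_form A \<eta> \<longleftrightarrow>
     (\<forall>p. \<forall>u\<in>tangent_space A p. \<forall>v\<in>tangent_space A p. \<eta> p (u + v) = \<eta> p u + \<eta> p v) \<and>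
     (\<forall>p c. \<forall>v\<in>tangent_space A p. \<eta> p (c \<odot> v) = c * \<eta> p v) \<and>
     (\<forall>X\<in>vector_fields A. app \<eta> X \<in> C_inf A)"

definition tensor_field11 :: "('a, 'e::euclidean_space) atlas \<Rightarrow> 'a tensor11 \<Rightarrow> bool" where
  "tensor_field11 A T \<longleftrightarrow>
     (\<forall>p. \<forall>v\<in>tangent_space A p. T p v \<in> tangent_space A p) \<and>
     (\<forall>p. \<forall>u\<in>tangent_space A p. \<forall>v\<in>tangent_space A p. T p (u + v) = T p u + T p v) \<and>
     (\<forall>p c. \<forall>v\<in>tangent_space A p. T p (c \<odot> v) = c \<odot> T p v) \<and>
     (\<forall>X\<in>vector_fields A. app T X \<in> vector_fields A)"

definition riemannian_metric :: "('a, 'e::euclidean_space) atlas \<Rightarrow> 'a bilin \<Rightarrow> bool" where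
  "riemannian_metric A g \<longleftrightarrow>
     (\<forall>p. \<forall>u\<in>tangent_space A p. \<forall>v\<in>tangent_space A p. \<forall>w\<in>tangent_space A p.
        g p (u + v) w = g p u w + g p v w) \<and>
     (\<forall>p c. \<forall>u\<in>tangent_space A p. \<forall>v\<in>tangent_space A p. g p (c \<odot> u) v = c * g p u v) \<and>
     (\<forall>p. \<forall>u\<in>tangent_space A p. \<forall>v\<in>tangent_space A p. g p u v = g p v u) \<and>
     (\<forall>p. \<forall>v\<in>tangent_space A p. v \<noteq> 0 \<longrightarrow> g p v v > 0) \<and>
     (\<forall>X\<in>vector_fields A. \<forall>Y\<in>vector_fields A. app2 g X Y \<in> C_inf A)"

text \<open>Nijenhuis tensor.\<close>

definition nijenhuis :: "'a tensor11 \<Rightarrow> 'a vfield \<Rightarrow> 'a vfield \<Rightarrow> 'a vfield" where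
  "nijenhuis T X Y = app T (app T (lie_bracket X Y)) + lie_bracket (app T X) (app T Y)
     - app T (lie_bracket (app T X) Y) - app T (lie_bracket X (app T Y))"


section \<open>Exterior calculus\<close>

text \<open>The normalisation is that of \<open>2 u \<and> v = u \<otimes> v - v \<otimes> u\<close>, i.e. the wedge product is the
  alternation (with factor \<open>1 / (k + l)!\<close>) of the tensor product; hence the factors \<open>1/2\<close> and \<open>1/3\<close>
  in the exterior derivatives of 1-forms and 2-forms.\<close>

definition d1 :: "'a form1 \<Rightarrow> 'a vfield \<Rightarrow> 'a vfield \<Rightarrow> 'a \<Rightarrow> real" where
  "d1 \<eta> X Y p = (X p (app \<eta> Y) - Y p (app \<eta> X) - app \<eta> (lie_bracket X Y) p) / 2"

definition d2 :: "'a bilin \<Rightarrow> 'a vfield \<Rightarrow> 'a vfield \<Rightarrow> 'a vfield \<Rightarrow> 'a \<Rightarrow> real" where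
  "d2 \<omega> X Y Z p =
     (X p (app2 \<omega> Y Z) + Y p (app2 \<omega> Z X) + Z p (app2 \<omega> X Y)
      - app2 \<omega> (lie_bracket X Y) Z p - app2 \<omega> (lie_bracket Y Z) X p
      - app2 \<omega> (lie_bracket Z X) Y p) / 3"

definition closed1 :: "('a, 'e::euclidean_space) atlas \<Rightarrow> 'a form1 \<Rightarrow> bool" where
  "closed1 A \<eta> \<longleftrightarrow> (\<forall>X\<in>vector_fields A. \<forall>Y\<in>vector_fields A. \<forall>p. d1 \<eta> X Y p = 0)"

definition closed2 :: "('a, 'e::euclidean_space) atlas \<Rightarrow> 'a bilin \<Rightarrow> bool" where
  "closed2 A \<omega> \<longleftrightarrow> (\<forall>X\<in>vector_fields A. \<forall>Y\<in>vector_fields A. \<forall>Z\<in>vector_fields A. \<forall>p.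
     d2 \<omega> X Y Z p = 0)"

text \<open>A \<open>k\<close>-form is represented by its action on sequences of vector fields, of which only the
  first \<open>k\<close> entries matter.\<close>

type_synonym 'a kform = "(nat \<Rightarrow> 'a vfield) \<Rightarrow> 'a \<Rightarrow> real"

definition wedge :: "nat \<Rightarrow> 'a kform \<Rightarrow> nat \<Rightarrow> 'a kform \<Rightarrow> 'a kform" where
  "wedge k \<omega> l \<theta> = (\<lambda>X p. (\<Sum>\<sigma> | \<sigma> permutes {..<k + l}.
     of_int (sign \<sigma>) * \<omega> (\<lambda>i. X (\<sigma> i)) p * \<theta> (\<lambda>i. X (\<sigma> (k + i))) p) / fact (k + l))"

primrec d1_power :: "'a form1 \<Rightarrow> nat \<Rightarrow> 'a kform" where
  "d1_power \<eta> 0 = (\<lambda>X p. 1)"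
| "d1_power \<eta> (Suc m) = wedge 2 (\<lambda>X. d1 \<eta> (X 0) (X 1)) (2 * m) (d1_power \<eta> m)"

definition form_has_odd_rank :: "('a, 'e::euclidean_space) atlas \<Rightarrow> 'a form1 \<Rightarrow> nat \<Rightarrow> bool" where
  "form_has_odd_rank A \<eta> r \<longleftrightarrow> (\<exists>m. r = 2 * m + 1 \<and>
     (\<forall>p. \<exists>X. (\<forall>i. X i \<in> vector_fields A) \<and>
        wedge 1 (\<lambda>X. app \<eta> (X 0)) (2 * m) (d1_power \<eta> m) X p \<noteq> 0) \<and>
     (\<forall>p X. (\<forall>i. X i \<in> vector_fields A) \<longrightarrow> d1_power \<eta> (m + 1) X p = 0))"


section \<open>Almost contact and almost 3-contact structures\<close>

definition almost_contact ::
  "('a, 'e::euclidean_space) atlas \<Rightarrow> 'a tensor11 \<Rightarrow> 'a vfield \<Rightarrow> 'a form1 \<Rightarrow> bool" where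
  "almost_contact A \<phi> \<xi> \<eta> \<longleftrightarrow>
     tensor_field11 A \<phi> \<and> \<xi> \<in> vector_fields A \<and> one_form A \<eta> \<and>
     (\<forall>p. \<forall>v\<in>tangent_space A p. \<phi> p (\<phi> p v) = - v + \<eta> p v \<odot> \<xi> p) \<and>
     (\<forall>p. \<eta> p (\<xi> p) = 1)"

definition normal_structure ::
  "('a, 'e::euclidean_space) atlas \<Rightarrow> 'a tensor11 \<Rightarrow> 'a vfield \<Rightarrow> 'a form1 \<Rightarrow> bool" where
  "normal_structure A \<phi> \<xi> \<eta> \<longleftrightarrow> (\<forall>X\<in>vector_fields A. \<forall>Y\<in>vector_fields A. \<forall>p.
     nijenhuis \<phi> X Y p + (2 * d1 \<eta> X Y p) \<odot> \<xi> p = 0)"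

definition compatible_metric ::
  "('a, 'e::euclidean_space) atlas \<Rightarrow> 'a tensor11 \<Rightarrow> 'a form1 \<Rightarrow> 'a bilin \<Rightarrow> bool" where
  "compatible_metric A \<phi> \<eta> g \<longleftrightarrow> (\<forall>p. \<forall>u\<in>tangent_space A p. \<forall>v\<in>tangent_space A p.
     g p (\<phi> p u) (\<phi> p v) = g p u v - \<eta> p u * \<eta> p v)"

definition fundamental_form :: "'a bilin \<Rightarrow> 'a tensor11 \<Rightarrow> 'a bilin" where
  "fundamental_form g \<phi> = (\<lambda>p u v. g p u (\<phi> p v))"

text \<open>The three structures are indexed by \<open>1, 2, 3 :: nat\<close>; the even permutations of
  \<open>(1, 2, 3)\<close> are the cyclic ones.\<close>

definition even_triples :: "(nat \<times> nat \<times> nat) set" where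
  "even_triples = {(1, 2, 3), (2, 3, 1), (3, 1, 2)}"

definition almost_3_contact_metric ::
  "('a::{t2_space,second_countable_topology}, 'e::euclidean_space) atlas \<Rightarrow>
   (nat \<Rightarrow> 'a tensor11) \<Rightarrow> (nat \<Rightarrow> 'a vfield) \<Rightarrow> (nat \<Rightarrow> 'a form1) \<Rightarrow> 'a bilin \<Rightarrow> bool" where
  "almost_3_contact_metric A \<phi> \<xi> \<eta> g \<longleftrightarrow>
     smooth_manifold A \<and> (\<exists>n. DIM('e) = 4 * n + 3) \<and> riemannian_metric A g \<and>
     (\<forall>\<alpha>\<in>{1, 2, 3}. almost_contact A (\<phi> \<alpha>) (\<xi> \<alpha>) (\<eta> \<alpha>) \<and> compatible_metric A (\<phi> \<alpha>) (\<eta> \<alpha>) g) \<and>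
     (\<forall>(\<alpha>, \<beta>, \<gamma>)\<in>even_triples. \<forall>p.
        (\<forall>v\<in>tangent_space A p.
           \<phi> \<gamma> p v = \<phi> \<alpha> p (\<phi> \<beta> p v) - \<eta> \<beta> p v \<odot> \<xi> \<alpha> p \<and>
           \<phi> \<gamma> p v = - \<phi> \<beta> p (\<phi> \<alpha> p v) + \<eta> \<alpha> p v \<odot> \<xi> \<beta> p \<and>
           \<eta> \<gamma> p v = \<eta> \<alpha> p (\<phi> \<beta> p v) \<and>
           \<eta> \<gamma> p v = - \<eta> \<beta> p (\<phi> \<alpha> p v)) \<and>
        \<xi> \<gamma> p = \<phi> \<alpha> p (\<xi> \<beta> p) \<and>
        \<xi> \<gamma> p = - \<phi> \<beta> p (\<xi> \<alpha> p))"

definition hyper_normal ::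
  "('a, 'e::euclidean_space) atlas \<Rightarrow>
   (nat \<Rightarrow> 'a tensor11) \<Rightarrow> (nat \<Rightarrow> 'a vfield) \<Rightarrow> (nat \<Rightarrow> 'a form1) \<Rightarrow> bool" where
  "hyper_normal A \<phi> \<xi> \<eta> \<longleftrightarrow> (\<forall>\<alpha>\<in>{1, 2, 3}. normal_structure A (\<phi> \<alpha>) (\<xi> \<alpha>) (\<eta> \<alpha>))"

definition three_quasi_Sasakian ::
  "('a::{t2_space,second_countable_topology}, 'e::euclidean_space) atlas \<Rightarrow>
   (nat \<Rightarrow> 'a tensor11) \<Rightarrow> (nat \<Rightarrow> 'a vfield) \<Rightarrow> (nat \<Rightarrow> 'a form1) \<Rightarrow> 'a bilin \<Rightarrow> bool" where
  "three_quasi_Sasakian A \<phi> \<xi> \<eta> g \<longleftrightarrow>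
     almost_3_contact_metric A \<phi> \<xi> \<eta> g \<and> hyper_normal A \<phi> \<xi> \<eta> \<and>
     (\<forall>\<alpha>\<in>{1, 2, 3}. closed2 A (fundamental_form g (\<phi> \<alpha>)))"

definition three_cosymplectic ::
  "('a::{t2_space,second_countable_topology}, 'e::euclidean_space) atlas \<Rightarrow>
   (nat \<Rightarrow> 'a tensor11) \<Rightarrow> (nat \<Rightarrow> 'a vfield) \<Rightarrow> (nat \<Rightarrow> 'a form1) \<Rightarrow> 'a bilin \<Rightarrow> bool" where
  "three_cosymplectic A \<phi> \<xi> \<eta> g \<longleftrightarrow>
     almost_3_contact_metric A \<phi> \<xi> \<eta> g \<and> hyper_normal A \<phi> \<xi> \<eta> \<and>
     (\<forall>\<alpha>\<in>{1, 2, 3}. closed1 A (\<eta> \<alpha>) \<and> closed2 A (fundamental_form g (\<phi> \<alpha>)))"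

definition has_rank ::
  "('a, 'e::euclidean_space) atlas \<Rightarrow> (nat \<Rightarrow> 'a form1) \<Rightarrow> nat \<Rightarrow> bool" where
  "has_rank A \<eta> r \<longleftrightarrow> (\<forall>\<alpha>\<in>{1, 2, 3}. form_has_odd_rank A (\<eta> \<alpha>) r)"


section \<open>The subbundles and the tensor fields \<open>\<psi>\<close>\<close>

text \<open>All subbundles are given by their spaces of smooth sections.\<close>

definition horizontal ::
  "('a, 'e::euclidean_space) atlas \<Rightarrow> (nat \<Rightarrow> 'a form1) \<Rightarrow> 'a vfield set" where
  "horizontal A \<eta> = {X \<in> vector_fields A. \<forall>\<alpha>\<in>{1, 2, 3}. \<forall>p. app (\<eta> \<alpha>) X p = 0}"

definition vertical ::
  "('a, 'e::euclidean_space) atlas \<Rightarrow> (nat \<Rightarrow> 'a vfield) \<Rightarrow> 'a vfield set" where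
  "vertical A \<xi> = {(\<lambda>p. f 1 p \<odot> \<xi> 1 p + f 2 p \<odot> \<xi> 2 p + f 3 p \<odot> \<xi> 3 p) |
     f :: nat \<Rightarrow> 'a \<Rightarrow> real. \<forall>\<alpha>\<in>{1, 2, 3}. f \<alpha> \<in> C_inf A}"

text \<open>\<open>E4m A \<eta> \<alpha>\<close> is defined by the kernel of \<open>d\<eta>\<^sub>\<alpha>\<close>; on a 3-quasi-Sasakian manifold with commuting
  Reeb vector fields it does not depend on \<open>\<alpha>\<close>.\<close>

definition E4m ::
  "('a, 'e::euclidean_space) atlas \<Rightarrow> (nat \<Rightarrow> 'a form1) \<Rightarrow> nat \<Rightarrow> 'a vfield set" where
  "E4m A \<eta> \<alpha> = {X \<in> horizontal A \<eta>. \<forall>Y\<in>vector_fields A. \<forall>p. d1 (\<eta> \<alpha>) X Y p = 0}"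

definition E4l ::
  "('a, 'e::euclidean_space) atlas \<Rightarrow> (nat \<Rightarrow> 'a form1) \<Rightarrow> 'a bilin \<Rightarrow> nat \<Rightarrow> 'a vfield set" where
  "E4l A \<eta> g \<alpha> = {X \<in> horizontal A \<eta>. \<forall>Y\<in>E4m A \<eta> \<alpha>. \<forall>p. app2 g X Y p = 0}"

definition E4m3 ::
  "('a, 'e::euclidean_space) atlas \<Rightarrow> (nat \<Rightarrow> 'a vfield) \<Rightarrow> (nat \<Rightarrow> 'a form1) \<Rightarrow> nat \<Rightarrow>
   'a vfield set" where
  "E4m3 A \<xi> \<eta> \<alpha> = {X + Y | X Y. X \<in> E4m A \<eta> \<alpha> \<and> Y \<in> vertical A \<xi>}"

text \<open>\<open>is_psi A \<phi> \<xi> \<eta> g \<alpha> T\<close> says that \<open>T\<close> is the tensor field \<open>\<psi>\<^sub>\<alpha>\<close>. As \<open>E4l\<close> and \<open>E4m3\<close> together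
  span all vector fields, these conditions determine \<open>T\<close>.\<close>

definition is_psi ::
  "('a, 'e::euclidean_space) atlas \<Rightarrow> (nat \<Rightarrow> 'a tensor11) \<Rightarrow> (nat \<Rightarrow> 'a vfield) \<Rightarrow>
   (nat \<Rightarrow> 'a form1) \<Rightarrow> 'a bilin \<Rightarrow> nat \<Rightarrow> 'a tensor11 \<Rightarrow> bool" where
  "is_psi A \<phi> \<xi> \<eta> g \<alpha> T \<longleftrightarrow> tensor_field11 A T \<and>
     (\<forall>X\<in>E4l A \<eta> g \<alpha>. app T X = app (\<phi> \<alpha>) X) \<and>
     (\<forall>X\<in>E4m3 A \<xi> \<eta> \<alpha>. app T X = 0)"

end

theory Submission
  imports Defs
begin

text \<open>Let \<open>(\<alpha>, \<beta>, \<gamma>)\<close> be an even permutation, let \<open>D\<close> be the Lie derivative along \<open>\<xi>\<^sub>\<alpha>\<close>, and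
  \<open>P = D \<phi>\<^sub>\<beta>\<close>. Normality and \<open>d\<Phi>\<^sub>\<alpha> = 0\<close> make \<open>\<xi>\<^sub>\<alpha>\<close> a Killing field, so commutation of the Reeb fields
  gives \<open>D \<eta>\<^sub>\<beta> = D \<eta>\<^sub>\<gamma> = 0\<close>. Since \<open>d\<Phi>\<^sub>\<beta> = 0\<close> and the contraction of \<open>\<Phi>\<^sub>\<beta>\<close> with \<open>\<xi>\<^sub>\<alpha>\<close> is \<open>\<eta>\<^sub>\<gamma>\<close>,
  Cartan's formula yields \<open>2 d\<eta>\<^sub>\<gamma>(Y, Z) = g(Y, P Z)\<close>; hence \<open>P\<close> is skew-symmetric and \<open>D P = 0\<close>.
  Applying \<open>D\<close> twice to \<open>\<phi>\<^sub>\<beta>\<^sup>2 = - I + \<eta>\<^sub>\<beta> \<otimes> \<xi>\<^sub>\<beta>\<close> gives \<open>2 P\<^sup>2 = 0\<close>, and a skew-symmetric endomorphism with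
  square zero vanishes.\<close>

section \<open>The algebra of smooth functions\<close>

text \<open>The Frechet derivative at a point of an open set depends only on nearby values, so
  agreement on \<open>S\<close> passes to all directional derivatives. The sum and product rules use
  this to replace the derivative of the combined function by its explicit formula.\<close>

lemma Ck_on_cong:
  assumes "open S" "\<And>x. x \<in> S \<Longrightarrow> f x = h x" "Ck_on k S f"
  shows "Ck_on k S h"
  using assms(2,3)
proof (induction k arbitrary: f h)
  case 0
  then show ?case by (simp cong: continuous_on_cong)
next
  case (Suc k)
  have D: "(h has_derivative frechet_derivative f (at x)) (at x)" if "x \<in> S" for x
  proof -
    have "(f has_derivative frechet_derivative f (at x)) (at x)"
      using Suc.prems(2) that by (simp add: frechet_derivative_works)
    then show ?thesis
      using has_derivative_transform_within_open[OF _ \<open>open S\<close> that] Suc.prems(1) by blast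
  qed
  then have "frechet_derivative f (at x) = frechet_derivative h (at x)" if "x \<in> S" for x
    using that frechet_derivative_at by blast
  then have "Ck_on k S (\<lambda>x. frechet_derivative h (at x) v)" for v
    using Suc.IH[of "\<lambda>x. frechet_derivative f (at x) v"] Suc.prems(2) by simp
  then show ?case
    using D by (auto simp: differentiable_def)
qed

lemma Ck_on_Suc_imp: "Ck_on (Suc k) S f \<Longrightarrow> Ck_on k S f"
proof (induction k arbitrary: f)
  case 0
  then show ?case
    by (simp add: continuous_at_imp_continuous_on differentiable_imp_continuous_within)
next
  case (Suc k)
  then show ?case by (metis Ck_on.simps(2))
qed

lemma Ck_on_const: "Ck_on k S (\<lambda>x. c)"
  by (induction k arbitrary: c) auto

lemma Ck_on_add:
  assumes "open S" "Ck_on k S f" "Ck_on k S h"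
  shows "Ck_on k S (\<lambda>x. f x + h x)"
  using assms(2,3)
proof (induction k arbitrary: f h)
  case 0
  then show ?case by (simp add: continuous_on_add)
next
  case (Suc k)
  have D: "((\<lambda>x. f x + h x) has_derivative
      (\<lambda>v. frechet_derivative f (at x) v + frechet_derivative h (at x) v)) (at x)"
    if "x \<in> S" for x
    using that Suc.prems by (intro has_derivative_add) (auto simp: frechet_derivative_works)
  have "Ck_on k S (\<lambda>x. frechet_derivative (\<lambda>x. f x + h x) (at x) v)" for v
  proof (rule Ck_on_cong[OF \<open>open S\<close>])
    show "Ck_on k S (\<lambda>x. frechet_derivative f (at x) v + frechet_derivative h (at x) v)"
      using Suc by auto
  qed (simp flip: frechet_derivative_at[OF D])
  then show ?case
    using D by (auto simp: differentiable_def)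
qed

lemma Ck_on_mult:
  fixes f h :: "'e::euclidean_space \<Rightarrow> real"
  assumes "open S" "Ck_on k S f" "Ck_on k S h"
  shows "Ck_on k S (\<lambda>x. f x * h x)"
  using assms(2,3)
proof (induction k arbitrary: f h)
  case 0
  then show ?case by (simp add: continuous_on_mult)
next
  case (Suc k)
  have D: "((\<lambda>x. f x * h x) has_derivative
      (\<lambda>v. f x * frechet_derivative h (at x) v + frechet_derivative f (at x) v * h x)) (at x)"
    if "x \<in> S" for x
    using that Suc.prems by (intro has_derivative_mult) (auto simp: frechet_derivative_works)
  have "Ck_on k S (\<lambda>x. frechet_derivative (\<lambda>x. f x * h x) (at x) v)" for v
  proof (rule Ck_on_cong[OF \<open>open S\<close>])
    show "Ck_on k S (\<lambda>x. f x * frechet_derivative h (at x) v + frechet_derivative f (at x) v * h x)"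
      \<comment> \<open>The product rule leaves one factor undifferentiated, so \<open>f\<close> and
        \<open>h\<close> themselves are also required at order \<open>k\<close>.\<close>
      using Suc.prems Suc.prems[THEN Ck_on_Suc_imp]
      by (intro Ck_on_add[OF \<open>open S\<close>] Suc.IH) simp_all
  qed (simp flip: frechet_derivative_at[OF D])
  then show ?case
    using D by (auto simp: differentiable_def)
qed

locale smooth_structure =
  fixes A :: "('a::{t2_space,second_countable_topology}, 'e::euclidean_space) atlas"
  assumes atlas: "smooth_atlas A"
begin

lemma open_chart_image: "(U, \<kappa>) \<in> A \<Longrightarrow> open (\<kappa> ` U)"
  using atlas by (auto simp: smooth_atlas_def)

lemma C_inf_const: "(\<lambda>p. c) \<in> C_inf A"
  by (auto simp: C_inf_def smooth_on_def o_def Ck_on_const)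

lemma C_inf_add: "f \<in> C_inf A \<Longrightarrow> h \<in> C_inf A \<Longrightarrow> (\<lambda>p. f p + h p) \<in> C_inf A"
  using open_chart_image by (fastforce simp: C_inf_def smooth_on_def o_def intro!: Ck_on_add)

lemma C_inf_mult: "f \<in> C_inf A \<Longrightarrow> h \<in> C_inf A \<Longrightarrow> (\<lambda>p. f p * h p) \<in> C_inf A"
  using open_chart_image by (fastforce simp: C_inf_def smooth_on_def o_def intro!: Ck_on_mult)

lemma C_inf_minus: "f \<in> C_inf A \<Longrightarrow> (\<lambda>p. - f p) \<in> C_inf A"
  using C_inf_mult[OF C_inf_const[of "-1"]] by simp

lemma C_inf_diff: "f \<in> C_inf A \<Longrightarrow> h \<in> C_inf A \<Longrightarrow> (\<lambda>p. f p - h p) \<in> C_inf A"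
  using C_inf_add[OF _ C_inf_minus] by simp

section \<open>Vector fields and Lie brackets\<close>

lemma vf_tangent: "X \<in> vector_fields A \<Longrightarrow> X p \<in> tangent_space A p"
  by (simp add: vector_fields_def)

lemma vf_smooth: "X \<in> vector_fields A \<Longrightarrow> f \<in> C_inf A \<Longrightarrow> (\<lambda>p. X p f) \<in> C_inf A"
  by (simp add: vector_fields_def)

lemma vf_nonsmooth: "X \<in> vector_fields A \<Longrightarrow> f \<notin> C_inf A \<Longrightarrow> X p f = 0"
  by (auto simp: vector_fields_def tangent_space_def)

lemma vf_add_fun:
  "\<lbrakk>X \<in> vector_fields A; f \<in> C_inf A; h \<in> C_inf A\<rbrakk> \<Longrightarrow> X p (\<lambda>q. f q + h q) = X p f + X p h"
  by (auto simp: vector_fields_def tangent_space_def)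

lemma vf_scale_fun:
  "\<lbrakk>X \<in> vector_fields A; f \<in> C_inf A\<rbrakk> \<Longrightarrow> X p (\<lambda>q. c * f q) = c * X p f"
  by (auto simp: vector_fields_def tangent_space_def)

lemma vf_mult_fun:
  "\<lbrakk>X \<in> vector_fields A; f \<in> C_inf A; h \<in> C_inf A\<rbrakk>
    \<Longrightarrow> X p (\<lambda>q. f q * h q) = f p * X p h + h p * X p f"
  by (auto simp: vector_fields_def tangent_space_def)

lemma vf_minus_fun:
  "\<lbrakk>X \<in> vector_fields A; f \<in> C_inf A\<rbrakk> \<Longrightarrow> X p (\<lambda>q. - f q) = - X p f"
  using vf_scale_fun[of X f p "-1"] by simp

lemma vf_diff_fun:
  "\<lbrakk>X \<in> vector_fields A; f \<in> C_inf A; h \<in> C_inf A\<rbrakk> \<Longrightarrow> X p (\<lambda>q. f q - h q) = X p f - X p h"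
  using vf_add_fun[OF _ _ C_inf_minus] by (simp add: vf_minus_fun)

text \<open>The Leibniz rule on \<open>1 * 1\<close> shows that the derivative of 1 equals twice
  itself; homogeneity then passes from 1 to \<open>c\<close>.\<close>

lemma vf_const_fun:
  assumes "X \<in> vector_fields A"
  shows "X p (\<lambda>q. c) = 0"
  using vf_mult_fun[OF assms C_inf_const C_inf_const, of p 1 1]
    vf_scale_fun[OF assms C_inf_const, of p c 1] by simp

lemmas C_inf_intros = C_inf_add C_inf_diff C_inf_minus C_inf_mult C_inf_const

text \<open>The left-hand sides are higher-order patterns only once the vector field is instantiated.\<close>

lemmas vf_simps = vf_add_fun vf_diff_fun vf_minus_fun vf_scale_fun vf_mult_fun vf_const_fun
  vf_smooth vf_nonsmooth

lemma vfI:
  assumes "\<And>p f h. \<lbrakk>f \<in> C_inf A; h \<in> C_inf A\<rbrakk> \<Longrightarrow> X p (\<lambda>q. f q + h q) = X p f + X p h"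
    and "\<And>p c f. f \<in> C_inf A \<Longrightarrow> X p (\<lambda>q. c * f q) = c * X p f"
    and "\<And>p f h. \<lbrakk>f \<in> C_inf A; h \<in> C_inf A\<rbrakk>
          \<Longrightarrow> X p (\<lambda>q. f q * h q) = f p * X p h + h p * X p f"
    and "\<And>p f. f \<notin> C_inf A \<Longrightarrow> X p f = 0"
    and "\<And>f. f \<in> C_inf A \<Longrightarrow> (\<lambda>p. X p f) \<in> C_inf A"
  shows "X \<in> vector_fields A"
  using assms by (auto simp: vector_fields_def tangent_space_def)

lemma vf_add:
  assumes X: "X \<in> vector_fields A" and Y: "Y \<in> vector_fields A"
  shows "X + Y \<in> vector_fields A"
  by (intro vfI) (simp_all add: vf_simps[OF X] vf_simps[OF Y] C_inf_intros algebra_simps)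

lemma vf_minus:
  assumes X: "X \<in> vector_fields A"
  shows "- X \<in> vector_fields A"
  by (intro vfI) (simp_all add: vf_simps[OF X] C_inf_intros algebra_simps)

lemma vf_diff:
  "X \<in> vector_fields A \<Longrightarrow> Y \<in> vector_fields A \<Longrightarrow> X - Y \<in> vector_fields A"
  using vf_add[OF _ vf_minus] by (simp only: diff_conv_add_uminus)

lemma vf_smult:
  assumes f: "f \<in> C_inf A" and X: "X \<in> vector_fields A"
  shows "(\<lambda>p. f p \<odot> X p) \<in> vector_fields A"
  by (intro vfI) (simp_all add: tscale_def vf_simps[OF X] f C_inf_intros algebra_simps)

text \<open>In the Leibniz rule the mixed products of first derivatives are symmetric in
  \<open>X\<close> and \<open>Y\<close>, so they cancel in the commutator.\<close>

lemma vf_bracket: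
  assumes X: "X \<in> vector_fields A" and Y: "Y \<in> vector_fields A"
  shows "lie_bracket X Y \<in> vector_fields A"
  by (intro vfI)
    (simp_all add: lie_bracket_def vf_simps[OF X] vf_simps[OF Y] C_inf_intros algebra_simps)

text \<open>Vector fields are 0 on non-smooth functions by convention, so only smooth arguments can
  tell them apart. The bracket identities below rely on this, since derivations are additive only on
  smooth functions.\<close>

lemma vf_eqI:
  assumes "X \<in> vector_fields A" "Y \<in> vector_fields A"
    and "\<And>p f. f \<in> C_inf A \<Longrightarrow> X p f = Y p f"
  shows "X = Y"
  using assms by (intro ext) (metis vf_nonsmooth)

lemma bracket_add_right:
  assumes X: "X \<in> vector_fields A" and Y: "Y \<in> vector_fields A" and Z: "Z \<in> vector_fields A"
  shows "lie_bracket X (Y + Z) = lie_bracket X Y + lie_bracket X Z"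
proof (rule vf_eqI)
  show "lie_bracket X (Y + Z) p f = (lie_bracket X Y + lie_bracket X Z) p f"
    if "f \<in> C_inf A" for p f
    by (simp add: that lie_bracket_def vf_simps[OF X] vf_simps[OF Y] vf_simps[OF Z])
qed (simp_all add: assms vf_add vf_bracket)

lemma bracket_minus_right:
  assumes X: "X \<in> vector_fields A" and Y: "Y \<in> vector_fields A"
  shows "lie_bracket X (- Y) = - lie_bracket X Y"
proof (rule vf_eqI)
  show "lie_bracket X (- Y) p f = (- lie_bracket X Y) p f" if "f \<in> C_inf A" for p f
    by (simp add: that lie_bracket_def vf_simps[OF X] vf_simps[OF Y])
qed (simp_all add: assms vf_minus vf_bracket)

lemma bracket_swap: "lie_bracket X Y = - lie_bracket Y X"
  by (simp add: lie_bracket_def fun_eq_iff)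

lemma bracket_smult_right:
  assumes X: "X \<in> vector_fields A" and Y: "Y \<in> vector_fields A" and f: "f \<in> C_inf A"
  shows "lie_bracket X (\<lambda>p. f p \<odot> Y p)
    = (\<lambda>p. X p f \<odot> Y p) + (\<lambda>p. f p \<odot> lie_bracket X Y p)"
proof (rule vf_eqI)
  show "lie_bracket X (\<lambda>p. f p \<odot> Y p) p h
      = ((\<lambda>p. X p f \<odot> Y p) + (\<lambda>p. f p \<odot> lie_bracket X Y p)) p h"
    if "h \<in> C_inf A" for p h
    by (simp add: that f lie_bracket_def tscale_def vf_simps[OF X] vf_simps[OF Y] algebra_simps)
qed (simp_all add: assms vf_add vf_bracket vf_smult vf_smooth)

text \<open>Written as the Leibniz rule for the Lie derivative along \<open>X\<close>, the form in
  which it is applied to the Reeb field later.\<close>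

lemma bracket_jacobi:
  assumes X: "X \<in> vector_fields A" and Y: "Y \<in> vector_fields A" and Z: "Z \<in> vector_fields A"
  shows "lie_bracket X (lie_bracket Y Z)
    = lie_bracket (lie_bracket X Y) Z + lie_bracket Y (lie_bracket X Z)"
proof (rule vf_eqI)
  show "lie_bracket X (lie_bracket Y Z) p f
      = (lie_bracket (lie_bracket X Y) Z + lie_bracket Y (lie_bracket X Z)) p f"
    if "f \<in> C_inf A" for p f
    by (simp add: that lie_bracket_def vf_simps[OF X] vf_simps[OF Y] vf_simps[OF Z])
qed (simp_all add: assms vf_add vf_bracket)

section \<open>One-forms and (1,1)-tensor fields acting on vector fields\<close>

lemma one_form_add:
  assumes "one_form A \<eta>" "X \<in> vector_fields A" "Y \<in> vector_fields A"
  shows "app \<eta> (X + Y) p = app \<eta> X p + app \<eta> Y p"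
  using assms by (simp add: one_form_def app_def vf_tangent)

lemma tscale_minus_one: "(-1) \<odot> v = - v"
  by (simp add: tscale_def fun_eq_iff)

lemma one_form_minus:
  assumes "one_form A \<eta>" "X \<in> vector_fields A"
  shows "app \<eta> (- X) p = - app \<eta> X p"
proof -
  have "\<eta> p ((-1) \<odot> X p) = (-1) * \<eta> p (X p)"
    using assms by (auto simp: one_form_def vf_tangent)
  then show ?thesis
    by (simp add: app_def tscale_minus_one)
qed

lemma one_form_smooth: "one_form A \<eta> \<Longrightarrow> X \<in> vector_fields A \<Longrightarrow> app \<eta> X \<in> C_inf A"
  by (simp add: one_form_def)

lemma d1_swap:
  assumes "one_form A \<eta>" "X \<in> vector_fields A" "Y \<in> vector_fields A"
  shows "d1 \<eta> Y X p = - d1 \<eta> X Y p"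
  using one_form_minus[OF assms(1) vf_bracket[OF assms(2,3)], of p]
  unfolding d1_def bracket_swap[of Y X] by (simp add: field_simps)

lemma tensor_vf: "tensor_field11 A T \<Longrightarrow> X \<in> vector_fields A \<Longrightarrow> app T X \<in> vector_fields A"
  by (simp add: tensor_field11_def)

lemma tensor_add:
  assumes "tensor_field11 A T" "X \<in> vector_fields A" "Y \<in> vector_fields A"
  shows "app T (X + Y) = app T X + app T Y"
  using assms by (simp add: tensor_field11_def app_def vf_tangent fun_eq_iff)

lemma tensor_minus:
  assumes "tensor_field11 A T" "X \<in> vector_fields A"
  shows "app T (- X) = - app T X"
proof
  fix p
  have "T p ((-1) \<odot> X p) = (-1) \<odot> T p (X p)"
    using assms by (auto simp: tensor_field11_def vf_tangent)
  then show "app T (- X) p = (- app T X) p"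
    by (simp add: app_def tscale_minus_one)
qed

lemma tensor_diff:
  assumes "tensor_field11 A T" "X \<in> vector_fields A" "Y \<in> vector_fields A"
  shows "app T (X - Y) = app T X - app T Y"
  using tensor_add[OF assms(1,2) vf_minus[OF assms(3)]] tensor_minus[OF assms(1,3)] by simp

lemma tensor_smult:
  assumes "tensor_field11 A T" "X \<in> vector_fields A"
  shows "app T (\<lambda>p. c p \<odot> X p) = (\<lambda>p. c p \<odot> app T X p)"
  using assms by (simp add: tensor_field11_def app_def vf_tangent)

lemma one_form_diff:
  assumes "one_form A \<eta>" "X \<in> vector_fields A" "Y \<in> vector_fields A"
  shows "app \<eta> (X - Y) p = app \<eta> X p - app \<eta> Y p"
  using one_form_add[OF assms(1,2) vf_minus[OF assms(3)]] one_form_minus[OF assms(1,3)] by simp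

lemma one_form_smult:
  assumes "one_form A \<eta>" "X \<in> vector_fields A"
  shows "app \<eta> (\<lambda>p. c p \<odot> X p) p = c p * app \<eta> X p"
  using assms by (simp add: one_form_def app_def vf_tangent)

lemma vf_zero: "0 \<in> vector_fields A"
  by (intro vfI) (simp_all add: C_inf_const)

lemma tensor_zero: "tensor_field11 A T \<Longrightarrow> app T 0 = 0"
  using tensor_diff[OF _ vf_zero vf_zero] by simp

lemma one_form_zero: "one_form A \<eta> \<Longrightarrow> app \<eta> 0 p = 0"
  using one_form_diff[OF _ vf_zero vf_zero] by simp

lemma bracket_zero_left: "X \<in> vector_fields A \<Longrightarrow> lie_bracket 0 X = 0"
  by (simp add: lie_bracket_def vf_const_fun fun_eq_iff)

end

section \<open>Almost contact metric structures\<close>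

locale riemannian = smooth_structure A
  for A :: "('a::{t2_space,second_countable_topology}, 'e::euclidean_space) atlas" +
  fixes g :: "'a bilin"
  assumes metric: "riemannian_metric A g"
begin

lemma g_smooth: "X \<in> vector_fields A \<Longrightarrow> Y \<in> vector_fields A \<Longrightarrow> app2 g X Y \<in> C_inf A"
  using metric by (simp add: riemannian_metric_def)

lemma g_sym:
  "X \<in> vector_fields A \<Longrightarrow> Y \<in> vector_fields A \<Longrightarrow> app2 g X Y p = app2 g Y X p"
  using metric by (simp add: riemannian_metric_def app2_def vf_tangent)

lemma g_add_left:
  "\<lbrakk>X \<in> vector_fields A; Y \<in> vector_fields A; Z \<in> vector_fields A\<rbrakk>
    \<Longrightarrow> app2 g (X + Y) Z p = app2 g X Z p + app2 g Y Z p"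
  using metric by (simp add: riemannian_metric_def app2_def vf_tangent)

lemma g_smult_left:
  "\<lbrakk>X \<in> vector_fields A; Y \<in> vector_fields A\<rbrakk>
    \<Longrightarrow> app2 g (\<lambda>p. c p \<odot> X p) Y p = c p * app2 g X Y p"
  using metric by (simp add: riemannian_metric_def app2_def vf_tangent)

lemma g_minus_left:
  assumes "X \<in> vector_fields A" "Y \<in> vector_fields A"
  shows "app2 g (- X) Y p = - app2 g X Y p"
proof -
  have "- X = (\<lambda>p. (-1) \<odot> X p)"
    by (simp add: fun_eq_iff tscale_def)
  then show ?thesis
    using g_smult_left[OF assms, of "\<lambda>p. -1" p] by simp
qed

lemma g_add_right:
  assumes "X \<in> vector_fields A" "Y \<in> vector_fields A" "Z \<in> vector_fields A"
  shows "app2 g Z (X + Y) p = app2 g Z X p + app2 g Z Y p"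
  using g_add_left[OF assms] g_sym[OF assms(3,1)] g_sym[OF assms(3,2)]
    g_sym[OF assms(3) vf_add[OF assms(1,2)]] by metis

lemma g_smult_right:
  assumes "X \<in> vector_fields A" "Y \<in> vector_fields A" "c \<in> C_inf A"
  shows "app2 g Y (\<lambda>p. c p \<odot> X p) p = c p * app2 g Y X p"
  using g_smult_left[OF assms(1,2)] g_sym[OF assms(2,1)]
    g_sym[OF assms(2) vf_smult[OF assms(3,1)]] by metis

lemma g_minus_right:
  assumes "X \<in> vector_fields A" "Y \<in> vector_fields A"
  shows "app2 g Y (- X) p = - app2 g Y X p"
  using g_minus_left[OF assms] g_sym[OF assms(2,1)] g_sym[OF assms(2) vf_minus[OF assms(1)]]
  by metis

lemma g_diff_right:
  assumes "X \<in> vector_fields A" "Y \<in> vector_fields A" "Z \<in> vector_fields A"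
  shows "app2 g Z (X - Y) p = app2 g Z X p - app2 g Z Y p"
  using g_add_right[OF assms(1) vf_minus[OF assms(2)] assms(3), of p]
    g_minus_right[OF assms(2,3), of p] by simp

lemma g_self_eq_0:
  assumes "X \<in> vector_fields A" "\<And>p. app2 g X X p = 0"
  shows "X = 0"
proof
  show "X p = 0 p" for p
    using metric vf_tangent[OF assms(1), of p] assms(2)[of p]
    unfolding riemannian_metric_def app2_def zero_fun_apply by (metis less_irrefl)
qed

text \<open>Testing with \<open>Z = X - Y\<close> gives \<open>X - Y\<close> length zero at every
  point.\<close>

lemma g_nondegenerate:
  assumes X: "X \<in> vector_fields A" and Y: "Y \<in> vector_fields A"
    and eq: "\<And>Z p. Z \<in> vector_fields A \<Longrightarrow> app2 g Z X p = app2 g Z Y p"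
  shows "X = Y"
proof -
  have "app2 g (X - Y) (X - Y) p = 0" for p
    using g_diff_right[OF X Y vf_diff[OF X Y], of p] eq[OF vf_diff[OF X Y], of p] by simp
  then show ?thesis
    using g_self_eq_0[OF vf_diff[OF X Y]] by simp
qed

end

section \<open>Identities of a single almost contact metric structure\<close>

locale almost_contact_metric = riemannian A g
  for A :: "('a::{t2_space,second_countable_topology}, 'e::euclidean_space) atlas"
    and g :: "'a bilin" +
  fixes \<phi> :: "'a tensor11" and \<xi> :: "'a vfield" and \<eta> :: "'a form1"
  assumes almost_contact: "almost_contact A \<phi> \<xi> \<eta>"
    and compatible: "compatible_metric A \<phi> \<eta> g"
begin

lemma phi: "tensor_field11 A \<phi>" and xi: "\<xi> \<in> vector_fields A" and eta: "one_form A \<eta>"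
  using almost_contact by (auto simp: almost_contact_def)

lemmas phi_vf = tensor_vf[OF phi]
lemmas eta_smooth = one_form_smooth[OF eta]

lemma eta_xi: "app \<eta> \<xi> p = 1"
  using almost_contact by (auto simp: almost_contact_def app_def)

lemma phi_phi:
  "X \<in> vector_fields A \<Longrightarrow> app \<phi> (app \<phi> X) = - X + (\<lambda>p. app \<eta> X p \<odot> \<xi> p)"
  using almost_contact by (auto simp: almost_contact_def app_def vf_tangent fun_eq_iff)

lemma smult_xi_eq_0: "c \<odot> \<xi> p = 0 \<Longrightarrow> c = 0"
proof -
  assume "c \<odot> \<xi> p = 0"
  moreover have "app \<eta> (\<lambda>p. c \<odot> \<xi> p) p = c"
    using one_form_smult[OF eta xi, of "\<lambda>p. c" p] eta_xi by simp
  ultimately show "c = 0"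
    using one_form_zero[OF eta, of p] by (simp add: app_def)
qed

text \<open>Put \<open>V = \<phi> \<xi>\<close>. The square of \<phi> sends \<xi> to
  \<open>- \<xi> + \<xi> = 0\<close>, so \<phi> kills \<open>V\<close>, and the same formula applied
  to \<open>V\<close> gives \<open>V = c \<xi>\<close>. Applying \<phi> once more yields
  \<open>0 = c V = c^2 \<xi>\<close>, hence \<open>c = 0\<close>.\<close>

lemma phi_xi: "app \<phi> \<xi> = 0"
proof -
  let ?V = "app \<phi> \<xi>"
  have V: "?V \<in> vector_fields A"
    by (simp add: phi_vf xi)
  have "app \<phi> ?V = 0"
    unfolding phi_phi[OF xi] by (simp add: eta_xi tscale_def fun_eq_iff)
  then obtain c where V_eq: "?V = (\<lambda>p. c p \<odot> \<xi> p)"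
    using phi_phi[OF V] tensor_zero[OF phi]
    by (metis add_uminus_conv_diff add.commute eq_iff_diff_eq_0)
  have "c p = 0" for p
  proof -
    have "app \<phi> ?V = (\<lambda>p. c p \<odot> ?V p)"
      using arg_cong[OF V_eq, of "app \<phi>"] tensor_smult[OF phi xi, of c] by simp
    then have "c p \<odot> ?V p = 0"
      using \<open>app \<phi> ?V = 0\<close> by (metis zero_fun_apply)
    moreover have "?V p = c p \<odot> \<xi> p"
      using V_eq by (rule fun_cong)
    ultimately have "(c p * c p) \<odot> \<xi> p = 0"
      by (simp add: tscale_def mult.assoc)
    then show ?thesis
      using smult_xi_eq_0 by force
  qed
  then show ?thesis
    using V_eq by (simp add: tscale_def fun_eq_iff)
qed

text \<open>Compute the cube of \<phi> in two ways: \<phi> after its square gives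
  \<open>- \<phi> X\<close> because \<open>\<phi> \<xi> = 0\<close>, while the square formula at
  \<open>\<phi> X\<close> adds the term \<open>\<eta> (\<phi> X) \<xi>\<close>.\<close>

lemma eta_phi:
  assumes X: "X \<in> vector_fields A"
  shows "app \<eta> (app \<phi> X) p = 0"
proof -
  have "app \<phi> (app \<phi> (app \<phi> X)) = app \<phi> (- X) + app \<phi> (\<lambda>p. app \<eta> X p \<odot> \<xi> p)"
    unfolding phi_phi[OF X]
    by (rule tensor_add[OF phi]) (simp_all add: vf_minus X vf_smult eta_smooth xi)
  also have "\<dots> = - app \<phi> X"
    unfolding tensor_minus[OF phi X] tensor_smult[OF phi xi] phi_xi
    by (simp add: tscale_def fun_eq_iff)
  finally have "(\<lambda>p. app \<eta> (app \<phi> X) p \<odot> \<xi> p) = 0"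
    using phi_phi[OF phi_vf[OF X]] by simp
  then have "app \<eta> (app \<phi> X) p \<odot> \<xi> p = 0"
    by (metis zero_fun_apply)
  then show ?thesis
    by (rule smult_xi_eq_0)
qed

lemma g_phi_phi:
  "\<lbrakk>X \<in> vector_fields A; Y \<in> vector_fields A\<rbrakk>
    \<Longrightarrow> app2 g (app \<phi> X) (app \<phi> Y) p = app2 g X Y p - app \<eta> X p * app \<eta> Y p"
  using compatible by (simp add: compatible_metric_def app_def app2_def vf_tangent)

text \<open>Compatibility with \<xi> as second argument, where the left side vanishes because
  \<open>\<phi> \<xi> = 0\<close>.\<close>

lemma g_xi:
  assumes X: "X \<in> vector_fields A"
  shows "app2 g X \<xi> p = app \<eta> X p" "app2 g \<xi> X p = app \<eta> X p"
proof -
  have "app2 g (app \<phi> X) 0 p = 0"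
    using g_diff_right[OF vf_zero vf_zero phi_vf[OF X]] by simp
  then show "app2 g X \<xi> p = app \<eta> X p"
    using g_phi_phi[OF X xi, of p] by (simp add: phi_xi eta_xi)
  then show "app2 g \<xi> X p = app \<eta> X p"
    using g_sym[OF X xi] by simp
qed

text \<open>Compatibility moves a further \<phi> onto both arguments of
  \<open>g(X, \<phi> Y)\<close>; then the square of \<phi> is expanded, and its \<xi>-term drops out
  because \<open>g(\<phi> X, \<xi>) = \<eta> (\<phi> X) = 0\<close>.\<close>

lemma phi_skew:
  assumes X: "X \<in> vector_fields A" and Y: "Y \<in> vector_fields A"
  shows "app2 g (app \<phi> X) Y p = - app2 g X (app \<phi> Y) p"
proof -
  have "app2 g X (app \<phi> Y) p = app2 g (app \<phi> X) (app \<phi> (app \<phi> Y)) p"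
    using g_phi_phi[OF X phi_vf[OF Y], of p] eta_phi[OF Y, of p] by simp
  also have "\<dots> = app2 g (app \<phi> X) (- Y) p
      + app2 g (app \<phi> X) (\<lambda>p. app \<eta> Y p \<odot> \<xi> p) p"
    unfolding phi_phi[OF Y]
    by (rule g_add_right) (simp_all add: assms vf_minus vf_smult eta_smooth xi phi_vf)
  also have "\<dots> = - app2 g (app \<phi> X) Y p + app \<eta> Y p * app2 g (app \<phi> X) \<xi> p"
    using g_minus_right[OF Y phi_vf[OF X]] g_smult_right[OF xi phi_vf[OF X] eta_smooth[OF Y]]
    by simp
  finally show ?thesis
    using X by (simp add: g_xi phi_vf eta_phi)
qed

lemma fundamental_form_eq: "app2 (fundamental_form g \<phi>) X Y = app2 g X (app \<phi> Y)"
  by (simp add: fundamental_form_def app2_def app_def)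

end

section \<open>Invariance of a quasi-Sasakian structure along its Reeb field\<close>

locale quasi_Sasakian = almost_contact_metric +
  assumes normal: "normal_structure A \<phi> \<xi> \<eta>"
    and closed_fundamental: "closed2 A (fundamental_form g \<phi>)"
begin

text \<open>Two of the four Nijenhuis terms contain \<open>\<phi> \<xi> = 0\<close>. The argument of
  the outer \<phi> is minus the Lie derivative of \<phi> along \<xi>, applied to
  \<open>X\<close>.\<close>

lemma normal_xi:
  assumes X: "X \<in> vector_fields A"
  shows "app \<phi> (app \<phi> (lie_bracket \<xi> X) - lie_bracket \<xi> (app \<phi> X)) p
    + (2 * d1 \<eta> \<xi> X p) \<odot> \<xi> p = 0"
proof -
  have "nijenhuis \<phi> \<xi> X = app \<phi> (app \<phi> (lie_bracket \<xi> X) - lie_bracket \<xi> (app \<phi> X))"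
    by (simp add: nijenhuis_def phi_xi bracket_zero_left X xi phi_vf vf_bracket
        tensor_zero[OF phi] tensor_diff[OF phi])
  moreover have "nijenhuis \<phi> \<xi> X p + (2 * d1 \<eta> \<xi> X p) \<odot> \<xi> p = 0"
    using normal X xi unfolding normal_structure_def by blast
  ultimately show ?thesis
    by metis
qed

text \<open>Apply \<eta> to \<open>normal_xi\<close>: the first summand dies because \<eta> vanishes
  on the image of \<phi>, and the second leaves its coefficient.\<close>

lemma d1_eta_xi:
  assumes X: "X \<in> vector_fields A"
  shows "d1 \<eta> \<xi> X p = 0"
proof -
  define W where "W = app \<phi> (lie_bracket \<xi> X) - lie_bracket \<xi> (app \<phi> X)"
  define c where "c = - (2 * d1 \<eta> \<xi> X p)"
  have W: "W \<in> vector_fields A"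
    by (simp add: W_def X xi phi_vf vf_bracket vf_diff)
  have "app \<phi> W p = c \<odot> \<xi> p"
    using normal_xi[OF X, of p] by (simp add: W_def c_def tscale_def fun_eq_iff eq_neg_iff_add_eq_0)
  then have "app \<eta> (app \<phi> W) p = app \<eta> (\<lambda>q. c \<odot> \<xi> q) p"
    by (simp add: app_def)
  then show ?thesis
    using eta_phi[OF W, of p] one_form_smult[OF eta xi, of "\<lambda>q. c" p] by (simp add: eta_xi c_def)
qed

text \<open>Cartan's formula: the contraction of \<open>d\<eta>\<close> with \<xi> vanishes, and
  \<open>\<eta> \<xi>\<close> is the constant 1.\<close>

lemma lie_eta:
  assumes X: "X \<in> vector_fields A"
  shows "\<xi> p (app \<eta> X) = app \<eta> (lie_bracket \<xi> X) p"
proof -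
  have "app \<eta> \<xi> = (\<lambda>p. 1)"
    by (simp add: eta_xi fun_eq_iff)
  then show ?thesis
    using d1_eta_xi[OF X, of p] vf_const_fun[OF X, of p 1] by (simp add: d1_def)
qed

text \<open>The difference \<open>W\<close> of the two sides is killed by \<phi>, by normality, and
  by \<eta>, by invariance of \<eta>. The formula for the square of \<phi> makes these two kernels
  meet only in 0.\<close>

lemma lie_phi:
  assumes X: "X \<in> vector_fields A"
  shows "lie_bracket \<xi> (app \<phi> X) = app \<phi> (lie_bracket \<xi> X)"
proof -
  define W where "W = app \<phi> (lie_bracket \<xi> X) - lie_bracket \<xi> (app \<phi> X)"
  have W: "W \<in> vector_fields A"
    by (simp add: W_def X xi phi_vf vf_bracket vf_diff)
  have "app \<phi> W p = 0" for p
    using normal_xi[OF X, of p] d1_eta_xi[OF X, of p] by (simp add: W_def tscale_def fun_eq_iff)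
  then have "app \<phi> W = 0"
    by (simp add: fun_eq_iff)
  moreover have "app \<eta> W p = 0" for p
  proof -
    have "app \<eta> (lie_bracket \<xi> (app \<phi> X)) p = \<xi> p (app \<eta> (app \<phi> X))"
      using lie_eta[OF phi_vf[OF X]] by simp
    also have "app \<eta> (app \<phi> X) = (\<lambda>p. 0)"
      using eta_phi[OF X] by (simp add: fun_eq_iff)
    finally show ?thesis
      unfolding W_def using X
      by (simp add: one_form_diff[OF eta] eta_phi phi_vf vf_bracket xi vf_const_fun[OF xi])
  qed
  then have "(\<lambda>p. app \<eta> W p \<odot> \<xi> p) = 0"
    by (simp add: tscale_def fun_eq_iff)
  ultimately have "W = 0"
    using phi_phi[OF W] tensor_zero[OF phi] by simp
  then show ?thesis
    by (simp add: W_def)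
qed

text \<open>Cartan's formula again: the fundamental form is closed, and its contraction with \<xi>
  is zero.\<close>

lemma lie_fundamental_form:
  assumes Y: "Y \<in> vector_fields A" and Z: "Z \<in> vector_fields A"
  shows "\<xi> p (app2 g Y (app \<phi> Z))
    = app2 g (lie_bracket \<xi> Y) (app \<phi> Z) p + app2 g Y (app \<phi> (lie_bracket \<xi> Z)) p"
proof -
  note YZ = vf_bracket[OF Y Z] and xY = vf_bracket[OF xi Y] and xZ = vf_bracket[OF xi Z]
  have "d2 (fundamental_form g \<phi>) \<xi> Y Z p = 0"
    using closed_fundamental xi Y Z by (simp add: closed2_def)
  moreover have "app2 g U (app \<phi> \<xi>) p = 0" if "U \<in> vector_fields A" for U p
    using g_diff_right[OF vf_zero vf_zero that] phi_xi by simp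
  then have "app2 g U (app \<phi> \<xi>) = (\<lambda>p. 0)" if "U \<in> vector_fields A" for U
    using that by (simp add: fun_eq_iff)
  moreover have "app2 g \<xi> (app \<phi> Y) = (\<lambda>p. 0)"
    using g_xi(2)[OF phi_vf[OF Y]] eta_phi[OF Y] by (simp add: fun_eq_iff)
  \<comment> \<open>The cyclic formula in \<open>d2\<close> produces \<open>[Z, \<xi>]\<close> in
    the first slot; the sign of the bracket and the sign from skewness of \<phi> cancel.\<close>
  moreover have "app2 g (lie_bracket Z \<xi>) (app \<phi> Y) p = app2 g Y (app \<phi> (lie_bracket \<xi> Z)) p"
    using g_minus_left[OF xZ phi_vf[OF Y], of p] phi_skew[OF xZ Y, of p]
      g_sym[OF phi_vf[OF xZ] Y, of p] by (simp add: bracket_swap[of Z])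
  ultimately show ?thesis
    by (simp add: d2_def fundamental_form_eq YZ Y Z vf_const_fun[OF Y] vf_const_fun[OF Z])
qed

text \<open>The metric is rebuilt from invariant pieces,
  \<open>g(U, V) = \<eta> U * \<eta> V - g(U, \<phi> (\<phi> V))\<close>, so invariance of \<eta>,
  \<phi> and the fundamental form gives that of \<open>g\<close>.\<close>

lemma xi_Killing:
  assumes Y: "Y \<in> vector_fields A" and Z: "Z \<in> vector_fields A"
  shows "\<xi> p (app2 g Y Z) = app2 g (lie_bracket \<xi> Y) Z p + app2 g Y (lie_bracket \<xi> Z) p"
proof -
  have g_eq: "app2 g U V p = app \<eta> U p * app \<eta> V p - app2 g U (app \<phi> (app \<phi> V)) p"
    if U: "U \<in> vector_fields A" and V: "V \<in> vector_fields A" for U V p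
    using g_phi_phi[OF U V, of p] phi_skew[OF U phi_vf[OF V], of p] by simp
  note fZ = phi_vf[OF Z] and xY = vf_bracket[OF xi Y] and xZ = vf_bracket[OF xi Z]
  have "\<xi> p (app2 g Y Z)
      = \<xi> p (\<lambda>p. app \<eta> Y p * app \<eta> Z p - app2 g Y (app \<phi> (app \<phi> Z)) p)"
    using g_eq[OF Y Z] by (metis (no_types, lifting) ext)
  also have "\<dots> = app \<eta> Y p * \<xi> p (app \<eta> Z) + app \<eta> Z p * \<xi> p (app \<eta> Y)
      - \<xi> p (app2 g Y (app \<phi> (app \<phi> Z)))"
    using vf_diff_fun[OF xi C_inf_mult[OF eta_smooth[OF Y] eta_smooth[OF Z]]
        g_smooth[OF Y phi_vf[OF fZ]], of p]
      vf_mult_fun[OF xi eta_smooth[OF Y] eta_smooth[OF Z], of p] by simp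
  also have "\<dots> = app2 g (lie_bracket \<xi> Y) Z p + app2 g Y (lie_bracket \<xi> Z) p"
    unfolding lie_eta[OF Y] lie_eta[OF Z] lie_fundamental_form[OF Y fZ] lie_phi[OF Z]
      g_eq[OF xY Z] g_eq[OF Y xZ] by simp
  finally show ?thesis .
qed

lemma lie_dual_form:
  assumes \<zeta>: "\<zeta> \<in> vector_fields A" "lie_bracket \<xi> \<zeta> = 0" and Y: "Y \<in> vector_fields A"
  shows "\<xi> p (app2 g \<zeta> Y) = app2 g \<zeta> (lie_bracket \<xi> Y) p"
proof -
  have "app2 g 0 Y p = 0"
    using g_diff_right[OF vf_zero vf_zero Y] g_sym[OF vf_zero Y] by simp
  then show ?thesis
    using xi_Killing[OF \<zeta>(1) Y] \<zeta>(2) by simp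
qed

end

section \<open>Commuting Reeb vector fields\<close>

text \<open>For an even permutation, the unprimed structure has index \<alpha>, the primed one index
  \<beta>, and \<theta>, \<zeta> stand for the form and Reeb field of index \<gamma>.
  \<open>\<theta>_comp\<close> identifies the contraction of the primed fundamental form with \<xi>;
  \<open>\<theta>_dual\<close> makes \<theta> invariant along \<xi>.\<close>

lemma (in riemannian) closed_third_form:
  assumes qS: "quasi_Sasakian A g \<phi> \<xi> \<eta>" "quasi_Sasakian A g \<phi>' \<xi>' \<eta>'"
    and \<theta>: "one_form A \<theta>"
    and \<theta>_comp: "\<And>X. X \<in> vector_fields A \<Longrightarrow> app \<theta> X = app \<eta> (app \<phi>' X)"
    and \<theta>_dual: "\<And>X. X \<in> vector_fields A \<Longrightarrow> app \<theta> X = app2 g \<zeta> X"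
    and \<zeta>: "\<zeta> \<in> vector_fields A"
    and comm: "lie_bracket \<xi> \<xi>' = 0" "lie_bracket \<xi> \<zeta> = 0"
  shows "closed1 A \<theta>"
proof -
  interpret a: quasi_Sasakian A g \<phi> \<xi> \<eta> by (rule qS)
  interpret b: quasi_Sasakian A g \<phi>' \<xi>' \<eta>' by (rule qS)
  define D where "D = lie_bracket \<xi>"
  define F where "F = app \<phi>'"
  define P where "P X = D (F X) - F (D X)" for X
  have D [simp]: "X \<in> vector_fields A \<Longrightarrow> D X \<in> vector_fields A" for X
    by (simp add: D_def vf_bracket a.xi)
  have F [simp]: "X \<in> vector_fields A \<Longrightarrow> F X \<in> vector_fields A" for X
    by (simp add: F_def b.phi_vf)
  have P [simp]: "X \<in> vector_fields A \<Longrightarrow> P X \<in> vector_fields A" for X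
    by (simp add: P_def vf_diff)
  have D_add: "D (X + Y) = D X + D Y" and F_add: "F (X + Y) = F X + F Y"
    if "X \<in> vector_fields A" "Y \<in> vector_fields A" for X Y
    using that by (simp_all add: D_def F_def bracket_add_right a.xi tensor_add[OF b.phi])
  have P_add: "P (X + Y) = P X + P Y"
    if "X \<in> vector_fields A" "Y \<in> vector_fields A" for X Y
    using that by (simp add: P_def D_add F_add)
  have DF: "D (F X) = P X + F (D X)" for X
    by (simp add: P_def)
  have lie_theta: "\<xi> p (app \<theta> X) = app \<theta> (D X) p" if "X \<in> vector_fields A" for X p
    using a.lie_dual_form[OF \<zeta> comm(2) that] that by (simp add: D_def \<theta>_dual vf_bracket a.xi)
  have dtheta: "2 * d1 \<theta> Y Z p = app2 g Y (P Z) p"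
    if Y: "Y \<in> vector_fields A" and Z: "Z \<in> vector_fields A" for Y Z p
  proof -
    \<comment> \<open>In the expansion of \<open>d2\<close> at \<open>(\<xi>, Y, Z)\<close>, every
      occurrence of \<xi> as an argument of the primed fundamental form becomes \<theta>, up to
      sign; the bracket terms with \<xi> are expressed through \<open>D\<close>.\<close>
    have left: "app2 g \<xi> (F X) = app \<theta> X" if "X \<in> vector_fields A" for X
      using a.g_xi(2)[of "F X"] that \<theta>_comp[OF that] by (simp add: F_def b.phi_vf fun_eq_iff)
    have right: "app2 g X (F \<xi>) = (\<lambda>p. - app \<theta> X p)" if "X \<in> vector_fields A" for X
    proof
      show "app2 g X (F \<xi>) p = - app \<theta> X p" for p
        using b.phi_skew[OF that a.xi, of p] a.g_xi(1)[OF F[OF that], of p] \<theta>_comp[OF that]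
        by (simp add: F_def)
    qed
    have third: "app2 g (lie_bracket Z \<xi>) (F Y) p = app2 g Y (F (D Z)) p"
      using g_minus_left[OF D[OF Z] F[OF Y], of p] b.phi_skew[OF D[OF Z] Y, of p]
        g_sym[OF F[OF D[OF Z]] Y, of p] by (simp add: bracket_swap[of Z] D_def F_def)
    have "d2 (fundamental_form g \<phi>') \<xi> Y Z p = 0"
      using b.closed_fundamental a.xi Y Z by (simp add: closed2_def)
    then have "\<xi> p (app2 g Y (F Z)) - Y p (app \<theta> Z) + Z p (app \<theta> Y) - app2 g (D Y) (F Z) p
        + app \<theta> (lie_bracket Y Z) p - app2 g Y (F (D Z)) p = 0"
      using left[OF Y] right[OF Z] right[OF vf_bracket[OF Y Z]] third
        vf_minus_fun[OF Y one_form_smooth[OF \<theta> Z]]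
      by (simp add: d2_def b.fundamental_form_eq D_def F_def)
    moreover have "\<xi> p (app2 g Y (F Z)) = app2 g (D Y) (F Z) p + app2 g Y (D (F Z)) p"
      using a.xi_Killing[OF Y F[OF Z]] by (simp add: D_def)
    ultimately have "2 * d1 \<theta> Y Z p = app2 g Y (D (F Z)) p - app2 g Y (F (D Z)) p"
      by (simp add: d1_def)
    then show ?thesis
      using g_diff_right[of "D (F Z)" "F (D Z)" Y p] Y Z by (simp add: P_def)
  qed
  \<comment> \<open>Differentiate \<open>dtheta\<close> along \<xi>. Since \<theta> is invariant, so
    is its exterior derivative; comparison with the Killing equation for \<open>g(Y, P Z)\<close>
    cancels the terms in \<open>D Y\<close>, and nondegeneracy removes \<open>Y\<close>.\<close>
  have DP: "D (P Z) = P (D Z)" if Z: "Z \<in> vector_fields A" for Z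
  proof (rule g_nondegenerate)
    show "app2 g Y (D (P Z)) p = app2 g Y (P (D Z)) p" if Y: "Y \<in> vector_fields A" for Y p
    proof -
      note smooth = one_form_smooth[OF \<theta>]
      have D_deriv: "\<xi> p (\<lambda>q. X q f) = D X p f + X p (\<lambda>q. \<xi> q f)" for X f
        by (simp add: D_def lie_bracket_def)
      have theta_fun: "(\<lambda>q. \<xi> q (app \<theta> X)) = app \<theta> (D X)" if "X \<in> vector_fields A" for X
        using lie_theta[OF that] by (simp add: fun_eq_iff)
      have "\<xi> p (\<lambda>q. 2 * d1 \<theta> Y Z q)
          = \<xi> p (\<lambda>q. Y q (app \<theta> Z) - Z q (app \<theta> Y) - app \<theta> (lie_bracket Y Z) q)"
        by (rule arg_cong[where f = "\<xi> p"]) (simp add: d1_def fun_eq_iff)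
      also have "\<dots> = \<xi> p (\<lambda>q. Y q (app \<theta> Z)) - \<xi> p (\<lambda>q. Z q (app \<theta> Y))
          - \<xi> p (app \<theta> (lie_bracket Y Z))"
        using vf_diff_fun[OF a.xi C_inf_diff[OF vf_smooth[OF Y smooth[OF Z]]
              vf_smooth[OF Z smooth[OF Y]]] smooth[OF vf_bracket[OF Y Z]], of p]
          vf_diff_fun[OF a.xi vf_smooth[OF Y smooth[OF Z]] vf_smooth[OF Z smooth[OF Y]], of p]
        by simp
      also have "\<dots> = D Y p (app \<theta> Z) + Y p (app \<theta> (D Z))
          - (D Z p (app \<theta> Y) + Z p (app \<theta> (D Y)))
          - (app \<theta> (lie_bracket (D Y) Z) p + app \<theta> (lie_bracket Y (D Z)) p)"
      proof -
        have "D (lie_bracket Y Z) = lie_bracket (D Y) Z + lie_bracket Y (D Z)"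
          unfolding D_def by (rule bracket_jacobi[OF a.xi Y Z])
        then show ?thesis
          using D_deriv[of Y "app \<theta> Z"] D_deriv[of Z "app \<theta> Y"] theta_fun[OF Y] theta_fun[OF Z]
            lie_theta[OF vf_bracket[OF Y Z], of p]
            one_form_add[OF \<theta> vf_bracket[OF D[OF Y] Z] vf_bracket[OF Y D[OF Z]], of p]
          by simp
      qed
      also have "\<dots> = 2 * d1 \<theta> (D Y) Z p + 2 * d1 \<theta> Y (D Z) p"
        by (simp add: d1_def field_simps)
      finally have "\<xi> p (app2 g Y (P Z)) = app2 g (D Y) (P Z) p + app2 g Y (P (D Z)) p"
        using dtheta[OF Y Z] dtheta[OF D[OF Y] Z] dtheta[OF Y D[OF Z]] by simp
      then show ?thesis
        using a.xi_Killing[OF Y P[OF Z], of p] by (simp add: D_def)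
    qed
  qed (simp_all add: Z)
  \<comment> \<open>This is the vanishing Lie derivative of the square of \<open>\<phi>'\<close>: on
    the right of \<open>phi_phi\<close>, both \<open>\<eta>'\<close> and \<open>\<xi>'\<close> are
    invariant along \<xi> because the Reeb fields commute.\<close>
  have PF: "P (F Z) + F (P Z) = 0" if Z: "Z \<in> vector_fields A" for Z
  proof -
    have "app \<eta>' X = app2 g \<xi>' X" if "X \<in> vector_fields A" for X
      using b.g_xi(2)[OF that] by (simp add: fun_eq_iff)
    then have "\<xi> p (app \<eta>' Z) = app \<eta>' (D Z) p" for p
      using a.lie_dual_form[OF b.xi comm(1) Z, of p] Z D[OF Z] by (simp add: D_def)
    then have "D (\<lambda>p. app \<eta>' Z p \<odot> \<xi>' p) = (\<lambda>p. app \<eta>' (D Z) p \<odot> \<xi>' p)"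
      using bracket_smult_right[OF a.xi b.xi b.eta_smooth[OF Z]] comm(1)
      by (simp add: D_def tscale_def fun_eq_iff)
    then have "D (F (F Z)) = F (F (D Z))"
      using b.phi_phi[OF Z] b.phi_phi[OF D[OF Z]]
        D_add[OF vf_minus[OF Z] vf_smult[OF b.eta_smooth[OF Z] b.xi]]
        bracket_minus_right[OF a.xi Z]
      by (simp add: F_def D_def)
    moreover have "D (F (F Z)) = P (F Z) + F (P Z) + F (F (D Z))"
      using Z by (simp add: DF F_add add.assoc)
    ultimately show ?thesis
      by simp
  qed
  have PP: "P (P Z) = 0" if Z: "Z \<in> vector_fields A" for Z
  proof -
    have "D 0 = 0"
      using D_add[OF vf_zero vf_zero] by simp
    then have "0 = D (P (F Z) + F (P Z))"
      using PF[OF Z] by simp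
    \<comment> \<open>As \<open>D\<close> commutes with \<open>P\<close>, it only acts on
      \<open>F\<close>, each time leaving a further \<open>P\<close>; the remaining bracket is
      \<open>PF\<close> at \<open>D Z\<close>.\<close>
    also have "\<dots> = P (P Z) + P (P Z) + (P (F (D Z)) + F (P (D Z)))"
      using Z by (simp add: D_add DP DF P_add algebra_simps)
    also have "\<dots> = P (P Z) + P (P Z)"
      using PF[OF D[OF Z]] by simp
    finally have double: "0 = P (P Z) + P (P Z)" .
    have "P (P Z) p f = 0" for p f
      using fun_cong[OF fun_cong[OF double, of p], of f] by simp
    then show ?thesis
      by (simp add: fun_eq_iff)
  qed
  \<comment> \<open>Skewness of \<open>P\<close> is the antisymmetry of \<open>d1 \<theta>\<close>
    read through \<open>dtheta\<close>; it turns \<open>g(P Z, P Z)\<close> into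
    \<open>- g(Z, P (P Z)) = 0\<close>.\<close>
  have "P Z = 0" if Z: "Z \<in> vector_fields A" for Z
  proof (rule g_self_eq_0)
    show "app2 g (P Z) (P Z) p = 0" for p
      using dtheta[OF P[OF Z] Z, of p] dtheta[OF Z P[OF Z], of p] d1_swap[OF \<theta> Z P[OF Z], of p]
        g_diff_right[OF vf_zero vf_zero Z, of p] by (simp add: PP[OF Z])
  qed (simp add: Z)
  then have "d1 \<theta> Y Z p = 0" if "Y \<in> vector_fields A" "Z \<in> vector_fields A" for Y Z p
    using dtheta[OF that, of p] that g_diff_right[OF vf_zero vf_zero that(1), of p] by simp
  then show ?thesis
    by (simp add: closed1_def)
qed

theorem theorem5p7:
  fixes A :: "('a::{t2_space,second_countable_topology}, 'e::euclidean_space) atlas"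
    and \<phi> :: "nat \<Rightarrow> 'a tensor11"
    and \<xi> :: "nat \<Rightarrow> 'a vfield"
    and \<eta> :: "nat \<Rightarrow> 'a form1"
    and g :: "'a bilin"
    and l :: nat
  assumes "three_quasi_Sasakian A \<phi> \<xi> \<eta> g"
    and "has_rank A \<eta> (4 * l + 1)"
    and "\<forall>\<alpha>\<in>{1, 2, 3}. \<forall>\<beta>\<in>{1, 2, 3}. lie_bracket (\<xi> \<alpha>) (\<xi> \<beta>) = 0"
    and "\<exists>\<alpha>\<in>{1, 2, 3}. \<exists>\<psi>. is_psi A \<phi> \<xi> \<eta> g \<alpha> \<psi> \<and>
           (\<forall>X\<in>vector_fields A. \<forall>Y\<in>vector_fields A. nijenhuis \<psi> X Y = 0)"
  shows "three_cosymplectic A \<phi> \<xi> \<eta> g"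
proof -
  have almost3: "almost_3_contact_metric A \<phi> \<xi> \<eta> g" and normal: "hyper_normal A \<phi> \<xi> \<eta>"
    and closed: "\<forall>\<alpha>\<in>{1, 2, 3}. closed2 A (fundamental_form g (\<phi> \<alpha>))"
    using assms(1) by (auto simp: three_quasi_Sasakian_def)
  interpret riemannian A g
    using almost3
    by unfold_locales (auto simp: almost_3_contact_metric_def smooth_manifold_def)
  have qS: "quasi_Sasakian A g (\<phi> \<alpha>) (\<xi> \<alpha>) (\<eta> \<alpha>)" if "\<alpha> \<in> {1, 2, 3}" for \<alpha>
    using almost3 normal closed that
    by unfold_locales (auto simp: almost_3_contact_metric_def hyper_normal_def)
  \<comment> \<open>Each of 1, 2, 3 is the last entry of one cyclic triple, so this covers all three
    forms.\<close>
  have "closed1 A (\<eta> \<gamma>)" if "(\<alpha>, \<beta>, \<gamma>) \<in> even_triples" for \<alpha> \<beta> \<gamma>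
  proof -
    have idx: "\<alpha> \<in> {1, 2, 3}" "\<beta> \<in> {1, 2, 3}" "\<gamma> \<in> {1, 2, 3}"
      using that by (auto simp: even_triples_def)
    interpret c: quasi_Sasakian A g "\<phi> \<gamma>" "\<xi> \<gamma>" "\<eta> \<gamma>"
      by (rule qS[OF idx(3)])
    have "\<forall>p. \<forall>v\<in>tangent_space A p. \<eta> \<gamma> p v = \<eta> \<alpha> p (\<phi> \<beta> p v)"
      using almost3 that unfolding almost_3_contact_metric_def by blast
    then have "app (\<eta> \<gamma>) X = app (\<eta> \<alpha>) (app (\<phi> \<beta>) X)" if "X \<in> vector_fields A" for X
      using that by (simp add: app_def vf_tangent)
    moreover have "app (\<eta> \<gamma>) X = app2 g (\<xi> \<gamma>) X" if "X \<in> vector_fields A" for X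
      using c.g_xi(2)[OF that] by (simp add: fun_eq_iff)
    ultimately show ?thesis
      using closed_third_form[OF qS[OF idx(1)] qS[OF idx(2)] c.eta _ _ c.xi] assms(3) idx
      by blast
  qed
  then have "\<forall>\<gamma>\<in>{1, 2, 3}. closed1 A (\<eta> \<gamma>)"
    by (auto simp: even_triples_def)
  then show ?thesis
    using almost3 normal closed by (simp add: three_cosymplectic_def)
qed

end
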